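(* Suppose that $p$ is prime with $p\equiv 5\pmod 8$ and let $g$ be a generator of the multiplicative group $\mathbb{Z}_p^*$. Let $M$ be the $4\times 4$ matrix whose $(i+1),(j+1)$-th entry is $|B_i\cap I_j|$ for $i,j\in\{0,1,2,3\}$, and let $k$ be an integer with $2\equiv g^k\pmod p$ (such a $k$ is necessarily odd, and its class modulo $4$ is well defined). Writing $(a,b,c,d)$ for the first row of $M$, one has \[ M=\begin{bmatrix} a&b&c&d\\ c&a&d&b\\ d&c&b&a\\ b&d&a&c\end{bmatrix}\quad\text{if } k\equiv 1\pmod 4, \qquad M=\begin{bmatrix} a&b&c&d\\ b&d&a&c\\ d&c&b&a\\ c&a&d&b\end{bmatrix}\quad\text{if } k\equiv 3\pmod 4. \] In particular, in both cases, if the entries $a,b,c,d$ of the first row are distinct, then $M$ is a Latin square (i.e. each of the values $a,b,c,d$ occurs exactly once in each row and exactly once in each column of $M$).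
   Context: The finite field $\mathbb{Z}_p$ is identified with the set of integers $\{0,1,\dots,p-1\}$, and $\mathbb{Z}_p^*=\{1,\dots,p-1\}$. For $i=0,1,2,3$, $B_i$ is the set of elements $x\in\mathbb{Z}_p^*$ of the form $x\equiv g^k\pmod p$ with $k\equiv i\pmod 4$ (the exponent $k$ is well defined modulo $4$ since $4\mid p-1$). For $j=0,1,2,3$, \[ I_j=\left\{x\in\mathbb{Z}_p^*:\ \frac{jp}{4}<x<\frac{(j+1)p}{4}\right\}, \] where the inequalities are between rational numbers, $x$ being regarded as an integer in $\{1,\dots,p-1\}$. *)

theory Defs
  imports
    "HOL-Number_Theory.Residues"
    "HOL-Algebra.Generated_Groups"
    "Jordan_Normal_Form.Matrix"
begin

text \<open>
  The carrier is the set of integers \<open>{1..p - 1}\<close> when \<open>p\<close> is prime. Powers with an integer exponent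
  are the group powers \<open>[^]\<close>, so a negative exponent refers to the inverse modulo \<open>p\<close>.
\<close>
abbreviation Zp_star :: "nat \<Rightarrow> int monoid" where
  "Zp_star p \<equiv> mult_of (residue_ring (int p))"

definition quartic_class :: "nat \<Rightarrow> int \<Rightarrow> nat \<Rightarrow> int set" where
  "quartic_class p g i =
     {x \<in> carrier (Zp_star p). \<exists>k::int. [x = g [^]\<^bsub>Zp_star p\<^esub> k] (mod int p) \<and> [k = int i] (mod 4)}"

definition quarter_interval :: "nat \<Rightarrow> nat \<Rightarrow> int set" where
  "quarter_interval p j =
     {x \<in> carrier (Zp_star p).
        (of_nat j * of_nat p / 4 :: rat) < of_int x \<and>
        (of_int x :: rat) < (of_nat j + 1) * of_nat p / 4}"

text \<open>Matrix indices start at \<open>0\<close>, so entry \<open>(i, j)\<close> lies in row \<open>i + 1\<close> and column \<open>j + 1\<close>.\<close>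
definition quartic_matrix :: "nat \<Rightarrow> int \<Rightarrow> nat mat" where
  "quartic_matrix p g = mat 4 4 (\<lambda>(i, j). card (quartic_class p g i \<inter> quarter_interval p j))"

definition latin_square :: "nat \<Rightarrow> 'a set \<Rightarrow> 'a mat \<Rightarrow> bool" where
  "latin_square n S M \<longleftrightarrow>
     M \<in> carrier_mat n n \<and> finite S \<and> card S = n \<and>
     (\<forall>v\<in>S. (\<forall>i<n. \<exists>!j. j < n \<and> M $$ (i, j) = v) \<and> (\<forall>j<n. \<exists>!i. i < n \<and> M $$ (i, j) = v))"

end

theory Submission
  imports Defs
begin

text \<open>
  Write \<open>N(i, j)\<close> for the number of elements of \<open>B\<^sub>i \<inter> I\<^sub>j\<close>. Two maps on the nonzero residues send
  quartic classes to quartic classes and interact well with the quarters of \<open>(0, p)\<close>.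

  Negation: since \<open>p \<equiv> 5 (mod 8)\<close>, the exponent \<open>(p - 1) / 2\<close> of \<open>-1\<close> is \<open>2\<close> modulo \<open>4\<close>, so
  \<open>x \<mapsto> p - x\<close> shows \<open>N(i, j) = N(i + 2, 3 - j)\<close> (\<open>cell_count_negate\<close>). Hence rows 2 and 3 are the
  reversals of rows 0 and 1.

  Doubling: \<open>x \<mapsto> 2 x mod p\<close> sends \<open>B\<^sub>i\<close> to \<open>B\<^sub>i\<^sub>+\<^sub>k\<close>. It maps \<open>I\<^sub>0\<close> and \<open>I\<^sub>2\<close> onto the even and the odd
  integers below \<open>p / 2\<close>, and \<open>I\<^sub>1\<close> and \<open>I\<^sub>3\<close> onto those above \<open>p / 2\<close>. This gives
  \<open>N(i, 0) + N(i, 2) = N(i + k, 0) + N(i + k, 1)\<close> and a similar equation for the upper half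
  (\<open>cell_count_double\<close>).

  Take \<open>k \<equiv> 1 (mod 4)\<close> and row 0 equal to \<open>(a, b, c, d)\<close>. The doubling equations into and out of row 1
  have exactly the solutions \<open>(c + t, a - t, d - t, b + t)\<close> for row 1, with one free
  parameter \<open>t\<close>. The quarters \<open>I\<^sub>0\<close> and \<open>I\<^sub>1\<close> have the same size, so the first two columns of the
  matrix have equal sums; these sums are \<open>a + b + c + d + 2 t\<close> and \<open>a + b + c + d - 2 t\<close>, which
  forces \<open>t = 0\<close>. The case \<open>k \<equiv> 3\<close> is the same with rows 1 and 3 exchanged.

  There is no third case because \<open>2\<close> is a nonresidue (\<open>odd_discrete_log_two\<close>): if \<open>u\<^sup>2 = -1\<close>, then
  \<open>(1 + u)\<^sup>2 = 2 u\<close>, while \<open>u\<close> has exponent \<open>(p - 1) / 4\<close> up to sign, an odd number.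
\<close>

section \<open>Discrete logarithms modulo \<open>p\<close>\<close>

locale primitive_root_5_mod_8 =
  fixes p :: nat and g :: int
  assumes prime_p: "prime p"
    and p_mod_8: "[p = 5] (mod 8)"
    and g_carrier: "g \<in> carrier (Zp_star p)"
    and g_generates: "generate (Zp_star p) {g} = carrier (Zp_star p)"
begin

text \<open>
  The logarithm is only meaningful modulo \<open>p - 1\<close>, and only for arguments strictly between \<open>0\<close> and
  \<open>p\<close>; the lemmas about it are therefore congruences.
\<close>
definition discrete_log :: "int \<Rightarrow> int" where
  "discrete_log x = (SOME n. x = g [^]\<^bsub>Zp_star p\<^esub> n)"

abbreviation cell_count :: "nat \<Rightarrow> nat \<Rightarrow> nat" where
  "cell_count i j \<equiv> card (quartic_class p g i \<inter> quarter_interval p j)"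

lemma p_form: obtains m :: int where "int p = 8 * m + 5" "m \<ge> 0"
proof
  have "p mod 8 = 5" using p_mod_8 by (simp add: cong_def)
  then have "p = 8 * (p div 8) + 5" using mult_div_mod_eq[of 8 p] by simp
  then show "int p = 8 * int (p div 8) + 5"
    by (metis of_nat_add of_nat_mult of_nat_numeral)
qed simp

lemma four_dvd_p_minus_1: "4 dvd int p - 1"
proof -
  obtain m where "int p = 8 * m + 5" "m \<ge> 0" by (rule p_form)
  then have "int p - 1 = 4 * (2 * m + 1)" by simp
  then show ?thesis by simp
qed

lemma carrier_Zp_star: "carrier (Zp_star p) = {0<..<int p}"
  by (auto simp: residue_ring_def)

lemma mult_Zp_star: "x \<otimes>\<^bsub>Zp_star p\<^esub> y = x * y mod int p"
  by (simp add: residue_ring_def)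

lemma group_Zp_star: "group (Zp_star p)"
proof -
  interpret residues_prime p "residue_ring (int p)"
    using prime_p by unfold_locales auto
  show ?thesis by (rule field_mult_group)
qed

sublocale Zp: group "Zp_star p"
  by (rule group_Zp_star)

lemma g_pow_in_range: "g [^]\<^bsub>Zp_star p\<^esub> (n :: int) \<in> {0<..<int p}"
  using Zp.int_pow_closed[OF g_carrier] carrier_Zp_star by blast

lemma ord_g: "int (Zp.ord g) = int p - 1"
  using Zp.generate_pow_card[OF g_carrier] prime_gt_1_nat[OF prime_p]
  by (simp only: g_generates carrier_Zp_star) simp

text \<open>
  A generator has order \<open>p - 1\<close>, so exponents are determined modulo \<open>p - 1\<close> and, a fortiori, modulo
  \<open>4\<close>.
\<close>
lemma g_pow_eq_iff:
  "g [^]\<^bsub>Zp_star p\<^esub> (m :: int) = g [^]\<^bsub>Zp_star p\<^esub> n \<longleftrightarrow> [m = n] (mod (int p - 1))"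
  by (simp only: Zp.int_pow_eq[OF g_carrier] ord_g cong_iff_dvd_diff dvd_diff_commute)

lemma cong_in_range_iff:
  assumes "x \<in> {0<..<int p}" "y \<in> {0<..<int p}"
  shows "[x = y] (mod int p) \<longleftrightarrow> x = y"
  using assms by (auto simp: cong_def)

lemma g_pow_discrete_log:
  assumes "x \<in> {0<..<int p}"
  shows "g [^]\<^bsub>Zp_star p\<^esub> discrete_log x = x"
proof -
  have "x \<in> generate (Zp_star p) {g}"
    using assms by (simp only: g_generates carrier_Zp_star)
  then have "\<exists>n :: int. x = g [^]\<^bsub>Zp_star p\<^esub> n"
    by (auto simp only: Zp.generate_pow[OF g_carrier])
  then have "x = g [^]\<^bsub>Zp_star p\<^esub> discrete_log x"
    unfolding discrete_log_def by (rule someI_ex)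
  then show ?thesis by (rule sym)
qed

lemma discrete_log_unique:
  assumes "x \<in> {0<..<int p}"
  shows "[x = g [^]\<^bsub>Zp_star p\<^esub> n] (mod int p) \<longleftrightarrow> [discrete_log x = n] (mod (int p - 1))"
  using g_pow_eq_iff[of "discrete_log x" n]
  unfolding cong_in_range_iff[OF assms g_pow_in_range] g_pow_discrete_log[OF assms] .

lemma discrete_log_inject:
  assumes "x \<in> {0<..<int p}" "y \<in> {0<..<int p}"
    and "[discrete_log x = discrete_log y] (mod (int p - 1))"
  shows "x = y"
  using assms(3) g_pow_eq_iff[of "discrete_log x" "discrete_log y"]
  unfolding g_pow_discrete_log[OF assms(1)] g_pow_discrete_log[OF assms(2)] by simp

lemma discrete_log_surj:
  obtains x where "x \<in> {0<..<int p}" "[discrete_log x = n] (mod (int p - 1))"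
  using g_pow_in_range discrete_log_unique[OF g_pow_in_range, THEN iffD1, OF cong_refl]
  by (rule that)

lemma discrete_log_mult:
  assumes "x \<in> {0<..<int p}" "y \<in> {0<..<int p}" "z \<in> {0<..<int p}"
    and "[x * y = z] (mod int p)"
  shows "[discrete_log x + discrete_log y = discrete_log z] (mod (int p - 1))"
proof -
  have "z = x \<otimes>\<^bsub>Zp_star p\<^esub> y"
    unfolding mult_Zp_star using assms(3,4) by (simp add: cong_def)
  then have "z = g [^]\<^bsub>Zp_star p\<^esub> (discrete_log x + discrete_log y)"
    using assms by (simp only: Zp.int_pow_mult[OF g_carrier] g_pow_discrete_log)
  then have "[z = g [^]\<^bsub>Zp_star p\<^esub> (discrete_log x + discrete_log y)] (mod int p)"
    by (rule subst) (rule cong_refl)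
  then have "[discrete_log z = discrete_log x + discrete_log y] (mod (int p - 1))"
    by (simp only: discrete_log_unique[OF assms(3)])
  then show ?thesis by (rule cong_sym)
qed

lemma cong_mod_4:
  assumes "[x = y] (mod (int p - 1))"
  shows "[x = y] (mod 4)"
  using assms four_dvd_p_minus_1 by (rule cong_dvd_modulus)

section \<open>Quartic classes and quarters as conditions on integers\<close>

text \<open>
  Any two exponents of \<open>x\<close> agree modulo \<open>4\<close>, so the existential quantifier over exponents can be
  replaced by the chosen logarithm.
\<close>
lemma quartic_class_iff:
  "x \<in> quartic_class p g i \<longleftrightarrow> x \<in> {0<..<int p} \<and> [discrete_log x = int i] (mod 4)"
proof (cases "x \<in> {0<..<int p}")
  case True
  have "(\<exists>n. [discrete_log x = n] (mod (int p - 1)) \<and> [n = int i] (mod 4)) \<longleftrightarrow>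
      [discrete_log x = int i] (mod 4)"
  proof
    assume "\<exists>n. [discrete_log x = n] (mod (int p - 1)) \<and> [n = int i] (mod 4)"
    then obtain n where "[discrete_log x = n] (mod 4)" "[n = int i] (mod 4)"
      using cong_mod_4 by auto
    then show "[discrete_log x = int i] (mod 4)" by (rule cong_trans)
  next
    assume "[discrete_log x = int i] (mod 4)"
    then show "\<exists>n. [discrete_log x = n] (mod (int p - 1)) \<and> [n = int i] (mod 4)"
      by (intro exI[of _ "discrete_log x"] conjI cong_refl)
  qed
  then show ?thesis
    unfolding quartic_class_def carrier_Zp_star mem_Collect_eq discrete_log_unique[OF True]
    by simp
next
  case False
  then show ?thesis
    unfolding quartic_class_def carrier_Zp_star mem_Collect_eq by blast
qed

lemma quartic_class_cong:
  assumes "[i = j] (mod 4)"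
  shows "quartic_class p g i = quartic_class p g j"
proof -
  have "[int i = int j] (mod 4)" using assms cong_int_iff[of i j 4] by simp
  then have "[n = int i] (mod 4) \<longleftrightarrow> [n = int j] (mod 4)" for n
    by (simp add: cong_def)
  then show ?thesis by (auto simp: quartic_class_iff)
qed

lemma quarter_interval_iff:
  "x \<in> quarter_interval p j \<longleftrightarrow>
     x \<in> {0<..<int p} \<and> int j * int p < 4 * x \<and> 4 * x < (int j + 1) * int p"
proof -
  have "(of_nat j * of_nat p / 4 :: rat) < of_int x \<longleftrightarrow>
      (of_int (int j * int p) :: rat) < of_int (4 * x)"
    by (simp add: field_simps)
  moreover have "(of_int x :: rat) < (of_nat j + 1) * of_nat p / 4 \<longleftrightarrow>
      (of_int (4 * x) :: rat) < of_int ((int j + 1) * int p)"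
    by (simp add: field_simps)
  ultimately show ?thesis
    unfolding quarter_interval_def carrier_Zp_star mem_Collect_eq of_int_less_iff by simp
qed

text \<open>
  Writing \<open>p = 8 m + 5\<close> turns the strict rational bounds into integer intervals; all later
  comparisons of positions are then linear.
\<close>
lemma quarter_interval_eq:
  assumes "int p = 8 * m + 5" "m \<ge> 0"
  shows "quarter_interval p 0 = {1..2 * m + 1}"
    and "quarter_interval p 1 = {2 * m + 2..4 * m + 2}"
    and "quarter_interval p 2 = {4 * m + 3..6 * m + 3}"
    and "quarter_interval p 3 = {6 * m + 4..8 * m + 4}"
proof -
  have iff: "x \<in> quarter_interval p j \<longleftrightarrow>
      0 < x \<and> x < 8 * m + 5 \<and> int j * (8 * m + 5) < 4 * x \<and> 4 * x < (int j + 1) * (8 * m + 5)"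
    for x j
    by (simp only: quarter_interval_iff assms(1) greaterThanLessThan_iff conj_assoc)
  show "quarter_interval p 0 = {1..2 * m + 1}"
    unfolding set_eq_iff iff atLeastAtMost_iff using assms(2) by (auto; linarith)
  show "quarter_interval p 1 = {2 * m + 2..4 * m + 2}"
    unfolding set_eq_iff iff atLeastAtMost_iff using assms(2) by (auto; linarith)
  show "quarter_interval p 2 = {4 * m + 3..6 * m + 3}"
    unfolding set_eq_iff iff atLeastAtMost_iff using assms(2) by (auto; linarith)
  show "quarter_interval p 3 = {6 * m + 4..8 * m + 4}"
    unfolding set_eq_iff iff atLeastAtMost_iff using assms(2) by (auto; linarith)
qed

lemma finite_quartic_class: "finite (quartic_class p g i)"
  by (rule finite_subset[of _ "{0<..<int p}"]) (auto simp: quartic_class_iff)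

section \<open>The logarithms of \<open>-1\<close> and of \<open>2\<close>\<close>

lemma one_in_range: "(1::int) \<in> {0<..<int p}"
  and two_in_range: "(2::int) \<in> {0<..<int p}"
  and minus_one_in_range: "int p - 1 \<in> {0<..<int p}"
proof -
  obtain m where "int p = 8 * m + 5" "m \<ge> 0" by (rule p_form)
  then have "int p \<ge> 5" by linarith
  then show "(1::int) \<in> {0<..<int p}" "(2::int) \<in> {0<..<int p}" "int p - 1 \<in> {0<..<int p}"
    by auto
qed

lemma mod_p_in_range:
  assumes "\<not> int p dvd x"
  shows "x mod int p \<in> {0<..<int p}"
proof -
  have "x mod int p \<noteq> 0" using assms by (simp add: dvd_eq_mod_eq_0)
  moreover have "0 \<le> x mod int p" "x mod int p < int p"
    using two_in_range by simp_all
  ultimately show ?thesis by simp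
qed

text \<open>
  The square of \<open>-1\<close> is \<open>1\<close> but \<open>-1 \<noteq> 1\<close>, so its logarithm is an odd multiple of \<open>(p - 1) / 2\<close>,
  and \<open>(p - 1) / 2 \<equiv> 2 (mod 4)\<close>.
\<close>
lemma discrete_log_minus_one: "[discrete_log (int p - 1) = 2] (mod 4)"
proof -
  obtain m where m: "int p = 8 * m + 5" "m \<ge> 0" by (rule p_form)
  let ?e = "discrete_log (int p - 1)"
  note one = one_in_range and minus_one = minus_one_in_range
  have "[1 * 1 = 1] (mod int p)" by simp
  then have log_one: "[discrete_log 1 = 0] (mod (int p - 1))"
    using discrete_log_mult[OF one one one] by (simp add: cong_iff_dvd_diff)
  have "(int p - 1) * (int p - 1) - 1 = int p * (int p - 2)"
    by (simp add: algebra_simps)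
  then have "[(int p - 1) * (int p - 1) = 1] (mod int p)"
    by (simp add: cong_iff_dvd_diff)
  then have "[?e + ?e = 0] (mod (int p - 1))"
    using discrete_log_mult[OF minus_one minus_one one] log_one cong_trans by blast
  then have "int p - 1 dvd ?e + ?e" by (simp only: cong_0_iff)
  then obtain q where "?e + ?e = (int p - 1) * q" ..
  then have q: "?e + ?e = (8 * m + 4) * q" using m(1) by simp
  then have e: "?e = (4 * m + 2) * q" by (simp add: algebra_simps)
  \<comment> \<open>An even \<open>q\<close> would make the logarithm a multiple of \<open>p - 1\<close>, hence \<open>-1 = 1\<close>.\<close>
  have "odd q"
  proof
    assume "even q"
    then obtain r where "q = 2 * r" ..
    then have "?e = (int p - 1) * r" using e m by (simp add: algebra_simps)
    then have "[?e = 0] (mod (int p - 1))" by (simp add: cong_0_iff)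
    then have "int p - 1 = 1"
      using discrete_log_inject[OF minus_one one] log_one cong_sym cong_trans by blast
    then show False using m by simp
  qed
  then obtain r where "q = 2 * r + 1" by (rule oddE)
  then have "?e - 2 = 4 * (m * q + r)" using e by (simp add: algebra_simps)
  then show ?thesis by (simp add: cong_iff_dvd_diff)
qed

text \<open>
  This is the second supplement to quadratic reciprocity for \<open>p \<equiv> 5 (mod 8)\<close>. The identity
  \<open>(1 + u)\<^sup>2 = 2 u + (1 + u\<^sup>2)\<close> with \<open>u\<^sup>2 = -1\<close> makes \<open>2 u\<close> a square, and such a \<open>u\<close> is itself a
  nonresidue because the logarithm of \<open>-1\<close> is not divisible by \<open>4\<close>.
\<close>
lemma odd_discrete_log_two: "odd (discrete_log 2)"
proof -
  note two = two_in_range and minus_one = minus_one_in_range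
  obtain l where l: "discrete_log (int p - 1) = 2 * l" "odd l"
  proof
    have "e = 2 * (e div 2) \<and> odd (e div 2)" if "[e = 2] (mod 4)" for e :: int
      using that by (simp only: cong_iff_dvd_diff) presburger
    then show "discrete_log (int p - 1) = 2 * (discrete_log (int p - 1) div 2)"
      and "odd (discrete_log (int p - 1) div 2)"
      using discrete_log_minus_one by blast+
  qed
  \<comment> \<open>Half of the logarithm of \<open>-1\<close> yields a square root \<open>u\<close> of \<open>-1\<close>.\<close>
  obtain u where u: "u \<in> {0<..<int p}" and log_u: "[discrete_log u = l] (mod (int p - 1))"
    by (rule discrete_log_surj)
  have odd_u: "odd (discrete_log u)"
    using cong_dvd_iff[OF cong_dvd_modulus[OF cong_mod_4[OF log_u]], of 2] l(2) by simp
  define v where "v = u * u mod int p"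
  have p_ndvd: "\<not> int p dvd u" using u by (auto dest: zdvd_imp_le)
  then have "\<not> int p dvd u * u"
    using prime_p by (simp add: prime_dvd_mult_iff)
  then have v: "v \<in> {0<..<int p}" unfolding v_def by (rule mod_p_in_range)
  have v_cong: "[u * u = v] (mod int p)" by (simp add: v_def cong_def)
  have "[discrete_log u + discrete_log u = 2 * l] (mod (int p - 1))"
    using cong_add[OF log_u log_u] by (simp only: mult_2)
  then have "v = int p - 1"
    using discrete_log_mult[OF u u v v_cong] l(1)
    by (intro discrete_log_inject v minus_one) (metis cong_sym cong_trans)
  then have u_sq: "[u * u = -1] (mod int p)"
    using v_cong by (simp add: cong_def)
  \<comment> \<open>Needed for \<open>1 + u\<close> to be nonzero: \<open>u\<close> has odd logarithm, \<open>-1\<close> an even one.\<close>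
  have "u \<noteq> int p - 1"
    using odd_u l(1) by auto
  then have w: "1 + u \<in> {0<..<int p}" using u by auto
  define z where "z = 2 * u mod int p"
  have "\<not> int p dvd 2" using two by (auto dest: zdvd_imp_le)
  then have "\<not> int p dvd 2 * u"
    using p_ndvd prime_p by (simp add: prime_dvd_mult_iff)
  then have z: "z \<in> {0<..<int p}" unfolding z_def by (rule mod_p_in_range)
  have z_cong: "[2 * u = z] (mod int p)" by (simp add: z_def cong_def)
  have "(1 + u) * (1 + u) - 2 * u = u * u - (-1)"
    by (simp add: algebra_simps)
  then have "[(1 + u) * (1 + u) = 2 * u] (mod int p)"
    using u_sq by (simp only: cong_iff_dvd_diff)
  then have "[discrete_log (1 + u) + discrete_log (1 + u) = discrete_log z] (mod 4)"
    using z_cong by (intro cong_mod_4 discrete_log_mult w z) (rule cong_trans)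
  then have "[discrete_log (1 + u) + discrete_log (1 + u) = discrete_log z] (mod 2)"
    by (rule cong_dvd_modulus) simp
  then have "even (discrete_log z)"
    by (auto dest: cong_dvd_iff)
  moreover have "[discrete_log 2 + discrete_log u = discrete_log z] (mod 4)"
    using z_cong by (intro cong_mod_4 discrete_log_mult two u z)
  then have "[discrete_log 2 + discrete_log u = discrete_log z] (mod 2)"
    by (rule cong_dvd_modulus) simp
  ultimately show ?thesis
    using odd_u by (auto dest: cong_dvd_iff)
qed

section \<open>Symmetries of the cell counts\<close>

text \<open>
  The bijection is \<open>x \<mapsto> p - x\<close>, which multiplies by \<open>-1\<close> and reflects \<open>(0, p)\<close>. It is its own
  inverse, up to identifying the class of index \<open>i + 4\<close> with that of index \<open>i\<close>.
\<close>
lemma cell_count_negate: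
  assumes "i' = i + 2" and "j + j' = 3"
  shows "cell_count i' j' = cell_count i j"
proof -
  have j: "j < 4" "3 - j = j'" "3 - j' = j" "j' < 4" using assms(2) by auto
  note minus_one = minus_one_in_range
  have cls: "int p - x \<in> quartic_class p g (i' + 2)" if x: "x \<in> quartic_class p g i'" for x i'
  proof -
    have x_range: "x \<in> {0<..<int p}" and x_log: "[discrete_log x = int i'] (mod 4)"
      using x by (auto simp: quartic_class_iff)
    have nx: "int p - x \<in> {0<..<int p}" using x_range by auto
    have "x * (int p - 1) - (int p - x) = int p * (x - 1)"
      by (simp add: algebra_simps)
    then have "[x * (int p - 1) = int p - x] (mod int p)" by (simp add: cong_iff_dvd_diff)
    then have "[discrete_log x + discrete_log (int p - 1) = discrete_log (int p - x)] (mod 4)"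
      by (intro cong_mod_4 discrete_log_mult x_range minus_one nx)
    moreover have "[discrete_log x + discrete_log (int p - 1) = int i' + 2] (mod 4)"
      by (intro cong_add x_log discrete_log_minus_one)
    ultimately have "[discrete_log (int p - x) = int (i' + 2)] (mod 4)"
      by (simp add: cong_def add.commute)
    then show ?thesis using nx by (simp add: quartic_class_iff)
  qed
  have ivl: "int p - x \<in> quarter_interval p (3 - j')"
    if "x \<in> quarter_interval p j'" "j' < 4" for x j'
    using that by (auto simp: quarter_interval_iff of_nat_diff algebra_simps)
  have "quartic_class p g (i + 2 + 2) = quartic_class p g i"
    by (rule quartic_class_cong) (simp add: cong_def)
  then have "bij_betw (\<lambda>x. int p - x)
      (quartic_class p g i \<inter> quarter_interval p j) (quartic_class p g i' \<inter> quarter_interval p j')"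
    using cls[of _ i] cls[of _ "i + 2"] ivl[OF _ j(1)] ivl[OF _ j(4)]
    unfolding assms(1) j(2,3)
    by (intro bij_betw_byWitness[where f' = "\<lambda>x. int p - x"]) auto
  then show ?thesis by (rule bij_betw_same_card[symmetric])
qed

lemma card_class_two_quarters:
  assumes "j < j'"
  shows "card (quartic_class p g i \<inter> (quarter_interval p j \<union> quarter_interval p j'))
       = cell_count i j + cell_count i j'"
proof -
  have "(int j + 1) * int p \<le> int j' * int p" using assms by (intro mult_right_mono) auto
  then have "quarter_interval p j \<inter> quarter_interval p j' = {}"
    by (auto simp: quarter_interval_iff)
  then show ?thesis
    unfolding Int_Un_distrib using finite_quartic_class
    by (subst card_Un_disjoint) auto
qed

lemma double_mod_eq:
  assumes "x \<in> {0<..<int p}"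
  shows "2 * x mod int p = (if 2 * x < int p then 2 * x else 2 * x - int p)"
proof (cases "2 * x < int p")
  case False
  have "2 * x mod int p = (2 * x - int p) mod int p" by simp
  also have "\<dots> = 2 * x - int p" using False assms by (intro mod_pos_pos_trivial) auto
  finally show ?thesis using False by simp
qed (use assms in simp)

text \<open>
  Multiplication by \<open>2\<close> shifts logarithms by the logarithm of \<open>2\<close>. On positions it sends \<open>I\<^sub>0 \<union> I\<^sub>2\<close>
  onto the lower half \<open>I\<^sub>0 \<union> I\<^sub>1\<close> and \<open>I\<^sub>1 \<union> I\<^sub>3\<close> onto the upper half \<open>I\<^sub>2 \<union> I\<^sub>3\<close>.
\<close>
lemma cell_count_double:
  assumes "[int i' = int i + discrete_log 2] (mod 4)"
  shows "cell_count i 0 + cell_count i 2 = cell_count i' 0 + cell_count i' 1"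
    and "cell_count i 1 + cell_count i 3 = cell_count i' 2 + cell_count i' 3"
proof -
  obtain m where m: "int p = 8 * m + 5" "m \<ge> 0" by (rule p_form)
  note two = two_in_range
  have double_in_range: "2 * x mod int p \<in> {0<..<int p}" if "x \<in> {0<..<int p}" for x
  proof -
    have "2 * x \<noteq> int p" using m(1) by presburger
    then show ?thesis
      using that unfolding double_mod_eq[OF that] by auto
  qed
  have cls: "2 * x mod int p \<in> quartic_class p g i' \<longleftrightarrow> x \<in> quartic_class p g i"
    if x: "x \<in> {0<..<int p}" for x
  proof -
    have log_double:
      "[discrete_log 2 + discrete_log x = discrete_log (2 * x mod int p)] (mod 4)"
      by (intro cong_mod_4 discrete_log_mult two x double_in_range) (simp add: cong_def)
    have i'_log: "[int i' = discrete_log 2 + int i] (mod 4)"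
      using assms by (simp add: add.commute)
    have "[discrete_log (2 * x mod int p) = int i'] (mod 4) \<longleftrightarrow>
        [discrete_log 2 + discrete_log x = discrete_log 2 + int i] (mod 4)"
      using log_double i'_log by (simp only: cong_def)
    also have "\<dots> \<longleftrightarrow> [discrete_log x = int i] (mod 4)"
      by (rule cong_add_lcancel)
    finally have "[discrete_log (2 * x mod int p) = int i'] (mod 4) \<longleftrightarrow>
        [discrete_log x = int i] (mod 4)" .
    then show ?thesis using x double_in_range[OF x] by (simp only: quartic_class_iff simp_thms)
  qed
  \<comment> \<open>The inverse of doubling: an odd residue \<open>y\<close> is the double of \<open>(y + p) / 2\<close>.\<close>
  define half where "half y = (if even y then y div 2 else (y + int p) div 2)" for y :: int
  have half_range: "half y \<in> {0<..<int p}" if "y \<in> {0<..<int p}" for y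
    using that unfolding half_def by auto
  have half_double: "half (2 * x mod int p) = x" if "x \<in> {0<..<int p}" for x
  proof -
    have "odd (int p)" using m(1) by simp
    then show ?thesis
      unfolding double_mod_eq[OF that] half_def by simp
  qed
  have double_half: "2 * half y mod int p = y" if "y \<in> {0<..<int p}" for y
  proof -
    have "odd (int p)" using m by simp
    then show ?thesis
      using that unfolding half_def by auto
  qed
  \<comment> \<open>Counting in a class is preserved by doubling; only the position sets need comparing.\<close>
  have transport: "card (quartic_class p g i \<inter> S) = card (quartic_class p g i' \<inter> T)"
    if S: "\<And>x. x \<in> {0<..<int p} \<Longrightarrow> x \<in> S \<longleftrightarrow> 2 * x mod int p \<in> T" for S T
  proof (rule bij_betw_same_card)
    show "bij_betw (\<lambda>x. 2 * x mod int p) (quartic_class p g i \<inter> S) (quartic_class p g i' \<inter> T)"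
    proof (rule bij_betw_byWitness[where f' = half])
      show "half ` (quartic_class p g i' \<inter> T) \<subseteq> quartic_class p g i \<inter> S"
      proof
        fix x assume "x \<in> half ` (quartic_class p g i' \<inter> T)"
        then obtain y where y: "x = half y" "y \<in> quartic_class p g i'" "y \<in> T" by auto
        have "y \<in> {0<..<int p}" using y(2) by (simp only: quartic_class_iff)
        note h = half_range[OF this] double_half[OF this]
        show "x \<in> quartic_class p g i \<inter> S"
          using y cls[OF h(1)] S[OF h(1)] by (simp only: h(2) Int_iff)
      qed
      show "(\<lambda>x. 2 * x mod int p) ` (quartic_class p g i \<inter> S) \<subseteq> quartic_class p g i' \<inter> T"
      proof
        fix y assume "y \<in> (\<lambda>x. 2 * x mod int p) ` (quartic_class p g i \<inter> S)"
        then obtain x where x: "y = 2 * x mod int p" "x \<in> quartic_class p g i" "x \<in> S" by auto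
        have "x \<in> {0<..<int p}" using x(2) by (simp only: quartic_class_iff)
        then show "y \<in> quartic_class p g i' \<inter> T"
          using x cls S by (simp only: Int_iff)
      qed
    qed (use half_double double_half in \<open>auto simp: quartic_class_iff\<close>)
  qed
  show "cell_count i 0 + cell_count i 2 = cell_count i' 0 + cell_count i' 1"
  proof -
    have "card (quartic_class p g i \<inter> (quarter_interval p 0 \<union> quarter_interval p 2))
        = card (quartic_class p g i' \<inter> (quarter_interval p 0 \<union> quarter_interval p 1))"
    proof (rule transport)
      fix x assume x: "x \<in> {0<..<int p}"
      show "x \<in> quarter_interval p 0 \<union> quarter_interval p 2 \<longleftrightarrow>
          2 * x mod int p \<in> quarter_interval p 0 \<union> quarter_interval p 1"
      proof (cases "2 * x < int p")
        case True
        then show ?thesis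
          using x m unfolding double_mod_eq[OF x] quarter_interval_eq[OF m] by auto
      next
        case False
        then have "2 * x \<ge> 8 * m + 6" using m(1) by presburger
        then show ?thesis
          using x m False unfolding double_mod_eq[OF x] quarter_interval_eq[OF m] by auto
      qed
    qed
    then show ?thesis by (simp add: card_class_two_quarters)
  qed
  show "cell_count i 1 + cell_count i 3 = cell_count i' 2 + cell_count i' 3"
  proof -
    have "card (quartic_class p g i \<inter> (quarter_interval p 1 \<union> quarter_interval p 3))
        = card (quartic_class p g i' \<inter> (quarter_interval p 2 \<union> quarter_interval p 3))"
    proof (rule transport)
      fix x assume x: "x \<in> {0<..<int p}"
      show "x \<in> quarter_interval p 1 \<union> quarter_interval p 3 \<longleftrightarrow>
          2 * x mod int p \<in> quarter_interval p 2 \<union> quarter_interval p 3"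
      proof (cases "2 * x < int p")
        case True
        then show ?thesis
          using x m unfolding double_mod_eq[OF x] quarter_interval_eq[OF m] by auto
      next
        case False
        then have "2 * x \<ge> 8 * m + 6" using m(1) by presburger
        then show ?thesis
          using x m False unfolding double_mod_eq[OF x] quarter_interval_eq[OF m] by auto
      qed
    qed
    then show ?thesis by (simp add: card_class_two_quarters)
  qed
qed

text \<open>
  The four quartic classes partition the nonzero residues.
\<close>
lemma column_sum:
  "cell_count 0 j + cell_count 1 j + cell_count 2 j + cell_count 3 j = card (quarter_interval p j)"
proof -
  have "quarter_interval p j = (\<Union>i\<in>{..<4}. quartic_class p g i \<inter> quarter_interval p j)"
  proof
    show "quarter_interval p j \<subseteq> (\<Union>i\<in>{..<4}. quartic_class p g i \<inter> quarter_interval p j)"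
    proof
      fix x assume x: "x \<in> quarter_interval p j"
      have "x \<in> quartic_class p g (nat (discrete_log x mod 4))"
        using x by (simp add: quartic_class_iff quarter_interval_iff cong_def)
      then show "x \<in> (\<Union>i\<in>{..<4}. quartic_class p g i \<inter> quarter_interval p j)"
        using x by (auto intro!: bexI[of _ "nat (discrete_log x mod 4)"])
    qed
  qed auto
  also have "card \<dots> = (\<Sum>i<4. cell_count i j)"
  proof (rule card_UN_disjoint)
    show "\<forall>i\<in>{..<4}. \<forall>i'\<in>{..<4}. i \<noteq> i' \<longrightarrow>
      quartic_class p g i \<inter> quarter_interval p j \<inter> (quartic_class p g i' \<inter> quarter_interval p j) = {}"
      by (auto simp: quartic_class_iff cong_def)
  qed (auto intro: finite_quartic_class)
  finally show ?thesis by (simp add: eval_nat_numeral)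
qed

text \<open>
  Equal column sums are the one relation that the two symmetries do not supply. Both quarters have
  \<open>(p - 1) / 4\<close> elements.
\<close>
lemma card_first_two_quarters: "card (quarter_interval p 0) = card (quarter_interval p 1)"
proof -
  obtain m where m: "int p = 8 * m + 5" "m \<ge> 0" by (rule p_form)
  show ?thesis by (simp only: quarter_interval_eq[OF m] card_atLeastAtMost_int)
qed

end

section \<open>Matrices with four rows and columns\<close>

lemma mat_4_eqI:
  assumes "M \<in> carrier_mat 4 4"
    and "\<And>j. j < 4 \<Longrightarrow> M $$ (0, j) = r0 ! j" "\<And>j. j < 4 \<Longrightarrow> M $$ (1, j) = r1 ! j"
    and "\<And>j. j < 4 \<Longrightarrow> M $$ (2, j) = r2 ! j" "\<And>j. j < 4 \<Longrightarrow> M $$ (3, j) = r3 ! j"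
  shows "M = mat_of_rows_list 4 [r0, r1, r2, r3]"
proof (rule eq_matI)
  fix i j :: nat
  assume "i < dim_row (mat_of_rows_list 4 [r0, r1, r2, r3])"
    and "j < dim_col (mat_of_rows_list 4 [r0, r1, r2, r3])"
  then have "i = 0 \<or> i = 1 \<or> i = 2 \<or> i = 3" and "j < 4"
    by (auto simp: mat_of_rows_list_def)
  then show "M $$ (i, j) = mat_of_rows_list 4 [r0, r1, r2, r3] $$ (i, j)"
    using assms by (auto simp: mat_of_rows_list_def)
qed (use assms(1) in \<open>auto simp: mat_of_rows_list_def\<close>)

lemma less_4_iff: "(i::nat) < 4 \<longleftrightarrow> i = 0 \<or> i = 1 \<or> i = 2 \<or> i = 3"
  by auto

lemma all_less_4: "(\<forall>i<4. P i) \<longleftrightarrow> P 0 \<and> P 1 \<and> P 2 \<and> P (3::nat)"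
  by (auto simp: less_4_iff)

lemma ex_less_4: "(\<exists>i<4. P i) \<longleftrightarrow> P 0 \<or> P 1 \<or> P 2 \<or> P (3::nat)"
  by (auto simp: less_4_iff)

text \<open>
  Splitting unique existence into existence and uniqueness lets bounded quantifiers be expanded into
  finitely many equations between matrix entries.
\<close>
lemma ex1_bounded_iff:
  "(\<exists>!i. i < n \<and> P i) \<longleftrightarrow> (\<exists>i<n. P i) \<and> (\<forall>i<n. \<forall>j<n. P i \<longrightarrow> P j \<longrightarrow> i = j)"
  for n :: nat
  by blast

lemma latin_square_two_orders:
  fixes a b c d :: 'a
  assumes "distinct [a, b, c, d]"
  shows "latin_square 4 {a, b, c, d}
      (mat_of_rows_list 4 [[a, b, c, d], [c, a, d, b], [d, c, b, a], [b, d, a, c]])"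
    and "latin_square 4 {a, b, c, d}
      (mat_of_rows_list 4 [[a, b, c, d], [b, d, a, c], [d, c, b, a], [c, a, d, b]])"
proof -
  have neq: "a \<noteq> b" "a \<noteq> c" "a \<noteq> d" "b \<noteq> c" "b \<noteq> d" "c \<noteq> d" using assms by auto
  note neqs = neq neq[symmetric]
  have dim: "mat_of_rows_list 4 [r0, r1, r2, r3] \<in> carrier_mat 4 4" for r0 r1 r2 r3 :: "'a list"
    by (auto simp: mat_of_rows_list_def)
  show "latin_square 4 {a, b, c, d}
      (mat_of_rows_list 4 [[a, b, c, d], [c, a, d, b], [d, c, b, a], [b, d, a, c]])"
    unfolding latin_square_def ex1_bounded_iff all_less_4 ex_less_4
    by (intro conjI dim; simp add: mat_of_rows_list_def neqs)
  show "latin_square 4 {a, b, c, d}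
      (mat_of_rows_list 4 [[a, b, c, d], [b, d, a, c], [d, c, b, a], [c, a, d, b]])"
    unfolding latin_square_def ex1_bounded_iff all_less_4 ex_less_4
    by (intro conjI dim; simp add: mat_of_rows_list_def neqs)
qed

section \<open>The matrix of quartic classes and quarters\<close>

theorem theorem1:
  fixes p :: nat and g k :: int and M :: "nat mat" and a b c d :: nat
  assumes "prime p" and "[p = 5] (mod 8)"
    and "g \<in> carrier (Zp_star p)" and "generate (Zp_star p) {g} = carrier (Zp_star p)"
    and "[2 = g [^]\<^bsub>Zp_star p\<^esub> k] (mod int p)"
    and "M = quartic_matrix p g"
    and "a = M $$ (0, 0)" and "b = M $$ (0, 1)" and "c = M $$ (0, 2)" and "d = M $$ (0, 3)"
  shows "odd k
    \<and> (\<forall>k'::int. [2 = g [^]\<^bsub>Zp_star p\<^esub> k'] (mod int p) \<longrightarrow> [k' = k] (mod 4))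
    \<and> ([k = 1] (mod 4) \<longrightarrow>
        M = mat_of_rows_list 4 [[a, b, c, d], [c, a, d, b], [d, c, b, a], [b, d, a, c]])
    \<and> ([k = 3] (mod 4) \<longrightarrow>
        M = mat_of_rows_list 4 [[a, b, c, d], [b, d, a, c], [d, c, b, a], [c, a, d, b]])
    \<and> (distinct [a, b, c, d] \<longrightarrow> latin_square 4 {a, b, c, d} M)"
proof -
  interpret primitive_root_5_mod_8 p g
    using assms(1-4) by unfold_locales
  have log_two: "[discrete_log 2 = k'] (mod 4)" if "[2 = g [^]\<^bsub>Zp_star p\<^esub> k'] (mod int p)" for k'
    using that discrete_log_unique[OF two_in_range] cong_mod_4 by blast
  have k_log: "[discrete_log 2 = k] (mod 4)" by (rule log_two[OF assms(5)])
  then have odd_k: "odd k"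
    using odd_discrete_log_two cong_dvd_iff[OF cong_dvd_modulus[OF k_log], of 2] by simp
  have M_dim: "M \<in> carrier_mat 4 4" by (simp add: assms(6) quartic_matrix_def)
  have entry: "M $$ (i, j) = cell_count i j" if "i < 4" "j < 4" for i j
    using that by (simp add: assms(6) quartic_matrix_def)
  have row_0: "a = cell_count 0 0" "b = cell_count 0 1" "c = cell_count 0 2" "d = cell_count 0 3"
    using assms(7-10) entry by auto
  have rows_2_3:
    "cell_count 2 0 = d" "cell_count 2 1 = c" "cell_count 2 2 = b" "cell_count 2 3 = a"
    "cell_count 3 0 = cell_count 1 3" "cell_count 3 1 = cell_count 1 2"
    "cell_count 3 2 = cell_count 1 1" "cell_count 3 3 = cell_count 1 0"
    unfolding row_0 by (rule cell_count_negate; simp)+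
  have columns: "cell_count 0 0 + cell_count 1 0 + cell_count 2 0 + cell_count 3 0
      = cell_count 0 1 + cell_count 1 1 + cell_count 2 1 + cell_count 3 1"
    by (simp only: column_sum card_first_two_quarters)
  have case_1: "M = mat_of_rows_list 4 [[a, b, c, d], [c, a, d, b], [d, c, b, a], [b, d, a, c]]"
    if "[k = 1] (mod 4)"
  proof -
    \<comment> \<open>Row 0 doubles into row 1, and row 1 into row 2.\<close>
    have log_1: "[discrete_log 2 = 1] (mod 4)" using k_log that by (rule cong_trans)
    have "[int 1 + discrete_log 2 = int 1 + 1] (mod 4)"
      using log_1 by (simp only: cong_add_lcancel)
    then have "[int 1 = int 0 + discrete_log 2] (mod 4)" "[int 2 = int 1 + discrete_log 2] (mod 4)"
      using log_1 by (auto simp: cong_def)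
    note cell_count_double[OF this(1)] cell_count_double[OF this(2)]
    then have "cell_count 1 0 = c" "cell_count 1 1 = a" "cell_count 1 2 = d" "cell_count 1 3 = b"
      using columns rows_2_3 row_0 by linarith+
    then show ?thesis
      by (intro mat_4_eqI M_dim) (auto simp: entry rows_2_3 row_0 less_4_iff simp del: One_nat_def)
  qed
  have case_3: "M = mat_of_rows_list 4 [[a, b, c, d], [b, d, a, c], [d, c, b, a], [c, a, d, b]]"
    if "[k = 3] (mod 4)"
  proof -
    \<comment> \<open>Row 0 doubles into row 3, and row 1 into row 0.\<close>
    have log_3: "[discrete_log 2 = 3] (mod 4)" using k_log that by (rule cong_trans)
    have "[int 1 + discrete_log 2 = int 1 + 3] (mod 4)"
      using log_3 by (simp only: cong_add_lcancel)
    then have "[int 3 = int 0 + discrete_log 2] (mod 4)" "[int 0 = int 1 + discrete_log 2] (mod 4)"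
      using log_3 by (auto simp: cong_def)
    note cell_count_double[OF this(1)] cell_count_double[OF this(2)]
    then have "cell_count 1 0 = b" "cell_count 1 1 = d" "cell_count 1 2 = a" "cell_count 1 3 = c"
      using columns rows_2_3 row_0 by linarith+
    then show ?thesis
      by (intro mat_4_eqI M_dim) (auto simp: entry rows_2_3 row_0 less_4_iff simp del: One_nat_def)
  qed
  have "[k = 1] (mod 4) \<or> [k = 3] (mod 4)"
    using odd_k by (simp add: cong_def) presburger
  then have "latin_square 4 {a, b, c, d} M" if "distinct [a, b, c, d]"
    using case_1 case_3 latin_square_two_orders[OF that] by metis
  then show ?thesis
    using odd_k case_1 case_3 log_two k_log cong_sym cong_trans by blast
qed

end
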